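(* For every integer $n \ge 4$, the sequence $(JL_{n,k})_{k \ge 0}$ is strictly increasing to the left of its mode $k^* = \lfloor \frac{n-4}{6} \rfloor + 1$, i.e. $JL_{n,0} < JL_{n,1} < \cdots < JL_{n,k^*}$.
   Context: For integers $n \ge 1$ and $k \ge 0$, $JL_{n,k} = \sum_{i=k}^{\lfloor n/2 \rfloor} \frac{n}{n-i} \binom{n-i}{i} \binom{i}{k}$, where an empty sum equals $0$. *)

theory Defs
  imports Complex_Main
begin

text \<open>The natural-number subtractions \<open>n - i\<close> do not truncate, since \<open>i \<le> n div 2\<close>, and
  \<open>n - i\<close> is positive for \<open>n \<ge> 1\<close>, the range in which the definition is meant.\<close>

definition JL :: "nat \<Rightarrow> nat \<Rightarrow> real" where
  "JL n k = (\<Sum>i = k..n div 2.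
     real n / real (n - i) * real ((n - i) choose i) * real (i choose k))"

text \<open>A mode is an index at which the maximal term of the sequence is attained.\<close>

definition is_mode :: "(nat \<Rightarrow> real) \<Rightarrow> nat \<Rightarrow> bool" where
  "is_mode a m \<longleftrightarrow> (\<forall>k. a k \<le> a m)"

end

theory Submission
  imports Defs
begin

text \<open>The polynomial \<open>F(y) = \<Sum>i. n / (n - i) * ((n - i) choose i) * y ^ i\<close> satisfies the
  hypergeometric equation \<open>y (1 + 4 y) F'' + ((1 - n) + (6 - 4 n) y) F' + n (n - 1) F = 0\<close>, and
  \<open>JL n k\<close> is the coefficient of \<open>x ^ k\<close> in \<open>F(1 + x)\<close>. This yields a three-term recurrence in
  \<open>k\<close>, through which lower and upper bounds on the ratio \<open>JL n (k + 1) / JL n k\<close> propagate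
  from \<open>k + 1\<close> down to \<open>k\<close>. In the limit \<open>k = \<kappa> n\<close> the ratio is \<open>g \<kappa> / \<kappa>\<close> with \<open>g\<close> convex and
  \<open>g (1/6) = 1/6\<close>; the lower bound comes from the tangent to \<open>g\<close> at \<open>1/6\<close> and the upper
  bound from its chord over \<open>[1/6, 1/2]\<close>. The lower bound, which is strict, is at least \<open>1\<close> if \<open>n \<ge> 6 k + 4\<close>, and the
  upper bound is at most \<open>1\<close> if \<open>n \<le> 6 k + 3\<close>.\<close>

section \<open>Three-term recurrence in \<open>k\<close>\<close>

definition lucas_coeff :: "nat \<Rightarrow> nat \<Rightarrow> real" where
  "lucas_coeff n i = real n / real (n - i) * real ((n - i) choose i)"

text \<open>A summation range free of \<open>k\<close> lets terms for \<open>k\<close>,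
  \<open>k + 1\<close>, \<open>k + 2\<close> be combined under one sum.\<close>

lemma JL_eq_sum_lucas_coeff:
  "JL n k = (\<Sum>i\<le>n div 2. lucas_coeff n i * real (i choose k))"
  unfolding JL_def lucas_coeff_def
  by (rule sum.mono_neutral_left) auto

lemma real_binomial_Suc_right:
  "(real k + 1) * real (i choose Suc k) = (real i - real k) * real (i choose k)"
proof (cases "k \<le> i")
  case True
  have "Suc k * (i choose Suc k) = (i - k) * (i choose k)"
    by (simp only: binomial_absorption binomial_absorb_comp)
  then have "real (Suc k) * real (i choose Suc k) = real (i - k) * real (i choose k)"
    by (metis of_nat_mult)
  with True show ?thesis by (simp add: of_nat_diff add.commute)
qed (simp add: binomial_eq_0)

lemma real_binomial_Suc_left:
  "(real m + 1) * real (m choose k) = (real m + 1 - real k) * real (Suc m choose k)"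
  using real_binomial_Suc_right[of "k - 1" m]
  by (cases k) (auto simp: algebra_simps)

text \<open>This is the coefficient of \<open>y ^ i\<close> in the hypergeometric equation.\<close>

lemma lucas_coeff_Suc:
  assumes "Suc i \<le> n div 2"
  shows "(real i + 1) * (real n - 1 - real i) * lucas_coeff n (Suc i)
    = (real n - 2 * real i) * (real n - 2 * real i - 1) * lucas_coeff n i"
proof -
  define m where "m = n - Suc i"
  have n: "n = m + i + 1" and m: "i < m"
    using assms by (auto simp: m_def)
  have 1: "(real i + 1) * real (m choose Suc i) = (real m - real i) * real (m choose i)"
    by (rule real_binomial_Suc_right)
  have 2: "(real m + 1) * real (m choose i) = (real m + 1 - real i) * real (Suc m choose i)"
    by (rule real_binomial_Suc_left)
  have "(real i + 1) * (real n - 1 - real i) * lucas_coeff n (Suc i)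
      = real n * ((real i + 1) * real (m choose Suc i))"
    using m by (simp add: lucas_coeff_def n)
  also have "\<dots> = real n * (real m - real i) * real (m choose i)"
    by (simp only: 1 mult.assoc)
  also have "real (m choose i) = (real m + 1 - real i) * real (Suc m choose i) / (real m + 1)"
    using 2 by (simp add: field_simps)
  also have "real n * (real m - real i) * \<dots>
      = (real n - 2 * real i) * (real n - 2 * real i - 1) * lucas_coeff n i"
    by (simp add: lucas_coeff_def n add.commute)
  finally show ?thesis .
qed

text \<open>The equation recentred at \<open>y = 1 + x\<close> and read off at \<open>x ^ k\<close>,
  proved without derivatives: the weighted sum of \<open>b i\<close> telescopes.\<close>

lemma JL_recurrence:
  "5 * (real k + 2) * (real k + 1) * JL n (k + 2)
    = (real k + 1) * (5 * real n - 7 - 9 * real k) * JL n (k + 1)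
      - (real n - 2 * real k) * (real n - 2 * real k - 1) * JL n k"
proof -
  define b where "b i = 5 * (real k + 2) * (real k + 1) * real (i choose (k + 2))
      - (real k + 1) * (5 * real n - 7 - 9 * real k) * real (i choose (k + 1))
      + (real n - 2 * real k) * (real n - 2 * real k - 1) * real (i choose k)" for i
  have b: "b i = ((real n - 2 * real i) * (real n - 2 * real i - 1)
      - (real n - real i) * (real i - real k)) * real (i choose k)" for i
  proof -
    have 1: "(real k + 1) * real (i choose (k + 1)) = (real i - real k) * real (i choose k)"
      using real_binomial_Suc_right[of k i] by simp
    have 2: "(real k + 2) * real (i choose (k + 2)) = (real i - real k - 1) * real (i choose (k + 1))"
      using real_binomial_Suc_right[of "k + 1" i] by (simp add: algebra_simps)
    have "b i = 5 * (real k + 1) * ((real k + 2) * real (i choose (k + 2)))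
      - (5 * real n - 7 - 9 * real k) * ((real k + 1) * real (i choose (k + 1)))
      + (real n - 2 * real k) * (real n - 2 * real k - 1) * real (i choose k)"
      unfolding b_def by (simp only: ac_simps)
    also have "\<dots> = (5 * (real i - real k - 1) - (5 * real n - 7 - 9 * real k))
         * ((real k + 1) * real (i choose (k + 1)))
      + (real n - 2 * real k) * (real n - 2 * real k - 1) * real (i choose k)"
      unfolding 2 by algebra
    finally show ?thesis unfolding 1 by algebra
  qed
  have "(\<Sum>i\<le>m. lucas_coeff n i * b i)
      = (real n - 2 * real m) * (real n - 2 * real m - 1) * lucas_coeff n m * real (m choose k)"
    if "m \<le> n div 2" for m
    using that
  proof (induction m)
    case 0
    show ?case by (cases k) (simp_all add: b)
  next
    case (Suc m)
    have "(\<Sum>i\<le>m. lucas_coeff n i * b i)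
      = ((real n - 2 * real m) * (real n - 2 * real m - 1) * lucas_coeff n m) * real (m choose k)"
      using Suc by simp
    also have "\<dots> = (real n - 1 - real m) * lucas_coeff n (Suc m) * ((real m + 1) * real (m choose k))"
      unfolding lucas_coeff_Suc[OF Suc.prems, symmetric] by (simp only: ac_simps)
    also have "\<dots> = (real n - 1 - real m) * lucas_coeff n (Suc m)
        * ((real m + 1 - real k) * real (Suc m choose k))"
      unfolding real_binomial_Suc_left ..
    finally show ?case
      by (simp add: b algebra_simps del: binomial_Suc_Suc)
  qed
  from this[of "n div 2"]
  have "(\<Sum>i\<le>n div 2. lucas_coeff n i * b i)
      = (real n - 2 * real (n div 2)) * (real n - 2 * real (n div 2) - 1)
        * lucas_coeff n (n div 2) * real (n div 2 choose k)"
    by simp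
  \<comment> \<open>The boundary term vanishes because \<open>n - 2 * (n div 2)\<close> is 0 or
    1.\<close>
  also have "(real n - 2 * real (n div 2)) * (real n - 2 * real (n div 2) - 1) = 0"
    by (cases "even n") (auto elim!: evenE oddE)
  finally have "(\<Sum>i\<le>n div 2. lucas_coeff n i * b i) = 0" by simp
  then show ?thesis
    unfolding JL_eq_sum_lucas_coeff b_def
    by (simp add: algebra_simps sum.distrib sum_subtractf sum_distrib_left)
qed

section \<open>Bounds on the ratio of consecutive terms\<close>

lemma JL_nonneg: "0 \<le> JL n k"
  unfolding JL_def by (intro sum_nonneg) simp

lemma JL_eq_0: "n < 2 * k \<Longrightarrow> JL n k = 0"
  unfolding JL_def by simp

lemma JL_pos:
  assumes "0 < n" "2 * k \<le> n"
  shows "0 < JL n k"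
proof -
  have "k \<in> {k..n div 2}" using assms by auto
  moreover have "0 < real n / real (n - k) * real ((n - k) choose k) * real (k choose k)"
    using assms by (auto simp: zero_less_binomial_iff)
  ultimately show ?thesis
    unfolding JL_def by (intro sum_pos2[where i = k]) auto
qed

text \<open>The tangent is \<open>(3 - 7 * \<kappa>) / 11\<close>. The second assumption makes the
  left factor positive and excludes the base case \<open>k = n\<close>.\<close>

lemma JL_ratio_lower:
  assumes "4 \<le> n" "7 * k + 1 < 3 * n"
  shows "(3 * real n - 7 * real k - 1) * JL n k < 11 * (real k + 1) * JL n (k + 1)"
proof -
  have "k \<le> n" using assms by simp
  then show ?thesis using assms(2)
  proof (induction k rule: inc_induct)
    case base
    then show ?case by simp
  next
    case (step k)
    define l where "l = 3 * real n - 7 * real k - 1"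
    \<comment> \<open>Inserting the bound at \<open>k + 1\<close> into 11 times the recurrence
      leaves \<open>q = 11 * (5 * n - 7 - 9 * k) - 5 * (3 * n - 7 * k - 8)\<close>; the step then
      reduces to \<open>l * q < 121 * s\<close>.\<close>
    define q where "q = 40 * real n - 64 * real k - 37"
    define s where "s = (real n - 2 * real k) * (real n - 2 * real k - 1)"
    have q: "0 < q" using step.prems assms(1) unfolding q_def by linarith
    \<comment> \<open>Tangency at \<open>n = 6 * k\<close> cancels the terms in
      \<open>k\<^sup>2\<close> and \<open>m * k\<close> of \<open>121 * s - l * q\<close>, leaving
      the quantity below.\<close>
    define m where "m = int n - 6 * int k"
    have m: "0 < m\<^sup>2 + 30 * m + 99 * int k - 37"
    proof -
      \<comment> \<open>Completing the square needs \<open>99 * k > 262\<close>; smaller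
        \<open>k\<close> use the lower bounds on \<open>n\<close>.\<close>
      consider "k = 0" | "k = 1" | "k = 2" | "3 \<le> k" by linarith
      then show ?thesis
      proof cases
        case 1
        then have "4 \<le> m" using assms(1) by (simp add: m_def)
        moreover from this have "4 * 4 \<le> m * m" by (intro mult_mono) simp_all
        ultimately show ?thesis unfolding power2_eq_square using 1 by linarith
      next
        case 2
        then have "0 \<le> (m + 2) * (m + 28)"
          using assms(1) by (intro mult_nonneg_nonneg) (auto simp: m_def)
        then show ?thesis using 2 assms(1) by (simp add: power2_eq_square algebra_simps)
      next
        case 3
        then have "0 < (m + 7) * (m + 23)"
          using step.prems by (intro mult_pos_pos) (auto simp: m_def)
        then show ?thesis using 3 by (simp add: power2_eq_square algebra_simps)
      next
        case 4
        have "0 \<le> (m + 15)\<^sup>2" by simp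
        also have "(m + 15)\<^sup>2 = m\<^sup>2 + 30 * m + 225" by algebra
        finally show ?thesis using 4 by linarith
      qed
    qed
    have "0 < real_of_int (m\<^sup>2 + 30 * m + 99 * int k - 37)"
      using m by (simp only: of_int_0_less_iff)
    also have "\<dots> = 121 * s - l * q"
      unfolding s_def l_def q_def m_def by (simp add: power2_eq_square algebra_simps)
    finally have lq: "l * q < 121 * s" by simp
    have IH: "(3 * real n - 7 * real k - 8) * JL n (k + 1) \<le> 11 * (real k + 2) * JL n (k + 2)"
    proof (cases "7 * Suc k + 1 < 3 * n")
      case True
      then show ?thesis using step.IH by (simp add: algebra_simps)
    next
      case False
      then have "3 * n \<le> 7 * k + 8" by simp
      then have "3 * real n - 7 * real k - 8 \<le> 0" by linarith
      then have "(3 * real n - 7 * real k - 8) * JL n (k + 1) \<le> 0"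
        by (intro mult_nonpos_nonneg JL_nonneg)
      also have "0 \<le> 11 * (real k + 2) * JL n (k + 2)"
        by (intro mult_nonneg_nonneg JL_nonneg) simp_all
      finally show ?thesis .
    qed
    have "(real k + 1) * ((3 * real n - 7 * real k - 8) * JL n (k + 1))
        \<le> (real k + 1) * (11 * (real k + 2) * JL n (k + 2))"
      by (rule mult_left_mono[OF IH]) simp
    with JL_recurrence[of k n]
    have "11 * (s * JL n k) \<le> (real k + 1) * JL n (k + 1) * q"
      unfolding s_def q_def by (simp add: algebra_simps)
    moreover have "l * q * JL n k < 121 * s * JL n k"
      using step.prems by (intro mult_strict_right_mono[OF lq] JL_pos) auto
    ultimately have "(l * JL n k) * q < (11 * (real k + 1) * JL n (k + 1)) * q"
      by (simp add: algebra_simps)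
    then show ?case using q unfolding l_def by simp
  qed
qed

text \<open>The chord is \<open>(1 - 2 * \<kappa>) / 4\<close>. The bound on \<open>n\<close>
  survives the passage to \<open>k + 1\<close>.\<close>

lemma JL_ratio_upper:
  assumes "4 \<le> n" "n \<le> 6 * k + 3" "k \<le> n"
  shows "4 * (real k + 1) * JL n (k + 1) \<le> (real n - 2 * real k + 1) * JL n k"
  using assms(3,2)
proof (induction k rule: inc_induct)
  case base
  show ?case using assms(1) by (simp add: JL_eq_0)
next
  case (step k)
  define s where "s = real n - 2 * real k"
  define q where "q = 15 * s + 4 * real k - 23"
  show ?case
  proof (cases "2 * k + 2 \<le> n")
    case False
    then have "n < 2 * (k + 1)" by simp
    then have 0: "JL n (k + 1) = 0" by (rule JL_eq_0)
    show ?thesis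
    proof (cases "2 * k \<le> n")
      case True
      then have "0 \<le> (real n - 2 * real k + 1) * JL n k"
        using JL_nonneg by (intro mult_nonneg_nonneg) auto
      then show ?thesis using 0 by simp
    qed (use 0 in \<open>simp add: JL_eq_0\<close>)
  next
    case True
    then have s2: "2 \<le> s" unfolding s_def by linarith
    have k: "1 \<le> real k" using assms(1) step.prems by simp
    have s4: "s \<le> 4 * real k + 3" using step.prems unfolding s_def by linarith
    \<comment> \<open>To leading order \<open>(s + 1) * q - 16 * s * (s - 1)\<close> is
      \<open>s * (4 * k - s)\<close>, with zeros at the chord's endpoints \<open>n = 2 * k\<close>
      and \<open>n = 6 * k\<close>.\<close>
    have "0 \<le> (s - 2) * (4 * real k + 3 - s) + 3 * s + 12 * real k - 17"
      using s2 s4 k mult_nonneg_nonneg[of "s - 2" "4 * real k + 3 - s"] by linarith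
    also have "\<dots> = (s + 1) * q - 16 * (s * (s - 1))"
      unfolding q_def by (simp add: algebra_simps)
    finally have sq: "16 * (s * (s - 1)) \<le> (s + 1) * q" by simp
    have IH: "4 * (real k + 2) * JL n (k + 2) \<le> (s - 1) * JL n (k + 1)"
      using step.IH step.prems unfolding s_def by (simp add: algebra_simps)
    have "(real k + 1) * (4 * (real k + 2) * JL n (k + 2))
        \<le> (real k + 1) * ((s - 1) * JL n (k + 1))"
      by (rule mult_left_mono[OF IH]) simp
    with JL_recurrence[of k n]
    have "(real k + 1) * JL n (k + 1) * q \<le> 4 * (s * (s - 1) * JL n k)"
      unfolding s_def q_def by (simp add: algebra_simps)
    then have "(s + 1) * ((real k + 1) * JL n (k + 1) * q) \<le> (s + 1) * (4 * (s * (s - 1) * JL n k))"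
      using s2 by (intro mult_left_mono) auto
    moreover have "16 * (s * (s - 1)) * ((real k + 1) * JL n (k + 1))
        \<le> (s + 1) * q * ((real k + 1) * JL n (k + 1))"
      using JL_nonneg by (intro mult_right_mono[OF sq]) auto
    ultimately have "(4 * (s * (s - 1))) * (4 * (real k + 1) * JL n (k + 1))
        \<le> (4 * (s * (s - 1))) * ((s + 1) * JL n k)"
      by (simp only: ac_simps)
    moreover have "0 < 4 * (s * (s - 1))" using s2 by simp
    ultimately show ?thesis unfolding s_def by (simp only: mult_le_cancel_left_pos)
  qed
qed

section \<open>Comparison of consecutive terms\<close>

lemma JL_less_Suc:
  assumes "6 * k + 4 \<le> n"
  shows "JL n k < JL n (k + 1)"
proof -
  have n: "6 * real k + 4 \<le> real n" using assms by linarith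
  \<comment> \<open>The comparison of factors is equivalent to
    \<open>6 * k + 4 \<le> n\<close>.\<close>
  have "11 * (real k + 1) * JL n k \<le> (3 * real n - 7 * real k - 1) * JL n k"
    using n by (intro mult_right_mono JL_nonneg) simp
  also have "\<dots> < 11 * (real k + 1) * JL n (k + 1)"
    using assms by (intro JL_ratio_lower) auto
  finally show ?thesis by simp
qed

lemma JL_Suc_le:
  assumes "4 \<le> n" "n \<le> 6 * k + 3"
  shows "JL n (k + 1) \<le> JL n k"
proof (cases "k \<le> n")
  case True
  have n: "real n \<le> 6 * real k + 3" using assms by linarith
  have "4 * (real k + 1) * JL n (k + 1) \<le> (real n - 2 * real k + 1) * JL n k"
    using assms True by (intro JL_ratio_upper)
  \<comment> \<open>Here it is equivalent to \<open>n \<le> 6 * k + 3\<close>, the complementary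
    range.\<close>
  also have "\<dots> \<le> 4 * (real k + 1) * JL n k"
    using n by (intro mult_right_mono JL_nonneg) simp
  finally show ?thesis by simp
next
  case False
  then show ?thesis by (simp add: JL_eq_0)
qed

theorem theorem3p1:
  fixes n :: nat
  assumes "n \<ge> 4"
  shows "is_mode (JL n) ((n - 4) div 6 + 1) \<and>
    (\<forall>k < (n - 4) div 6 + 1. JL n k < JL n (k + 1))"
proof -
  define m where "m = (n - 4) div 6 + 1"
  \<comment> \<open>Since \<open>4 \<le> n\<close>, \<open>k < m\<close> means exactly
    \<open>6 * k + 4 \<le> n\<close>.\<close>
  have less: "JL n k < JL n (k + 1)" if "k < m" for k
    using that assms unfolding m_def by (intro JL_less_Suc) linarith
  have le: "JL n (k + 1) \<le> JL n k" if "m \<le> k" for k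
    using that assms unfolding m_def by (intro JL_Suc_le) linarith+
  have "JL n k \<le> JL n m" for k
  proof (cases "k \<le> m")
    case True
    then show ?thesis
    proof (induction k rule: inc_induct)
      case (step k)
      then show ?case using less[of k] by simp
    qed simp
  next
    case False
    then have "m \<le> k" by simp
    then show ?thesis
    proof (induction k rule: dec_induct)
      case (step k)
      then show ?case using le[of k] by simp
    qed simp
  qed
  with less show ?thesis unfolding is_mode_def m_def by blast
qed

end
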